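(* Let $F$ be a field of characteristic $0$, let $\lambda,m,r,\eta,\tau\in F$, and let $(H_n)_{n\ge 0}$ be the sequence with $H_0=1$, $H_1=\lambda$, $H_2=m$, $H_3=r$, $H_4=\eta$ and $$H_{n+4}H_n=H_{n+3}H_{n+1}+\tau H_{n+2}^2\qquad(n\ge 1).$$ Assume $H_n\neq 0$ for all $n\ge 1$ (so that the recurrence determines the sequence); this includes the generic case of independent indeterminates $\lambda,m,r,\eta,\tau$ over $\mathbb{Q}$ with $F=\mathbb{Q}(\lambda,m,r,\eta,\tau)$. Define $$c_0=\lambda,\quad c_1=\frac{r}{\lambda},\quad c_2=\frac{m}{\lambda r},\quad c_3=\frac{\lambda\eta}{mr},\quad c_4=\frac{r^2}{m\eta},\quad c_5=\frac{\tau mr}{\lambda\eta}+\frac{m^2}{\lambda r},$$ and, for $k\ge 3$, $$c_{2k}=\frac{1}{c_{2k-2}c_{2k-1}},\qquad c_{2k+1}=c_{2k-2}+\frac{\tau}{c_{2k-1}}.$$ Then all $c_j$ are well defined and nonzero, and the formal power series $G(x)=\sum_{n\ge 0}g_nx^n\in F[[x]]$ given by the Stieltjes continued fraction with coefficients $(c_j)_{j\ge 0}$ satisfies, for every $n\ge 1$, $$\det(g_{i+j})_{0\le i,j\le n-1}=H_n,\qquad \det(g_{i+j+1})_{0\le i,j\le n-1}=H_{n+2}.$$ Moreover, for $n\ge 2$, $$c_{2n-1}=\frac{H_{n-1}H_{n+2}}{H_nH_{n+1}},\qquad c_{2n}=\frac{H_{n+1}^2}{H_nH_{n+2}}.$$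
   Context: The Stieltjes continued fraction with coefficients $(c_j)_{j\ge 0}$ is $$G(x)=\cfrac{c_0}{1-\cfrac{c_1x}{1-\cfrac{c_2x}{1-\cfrac{c_3x}{\ddots}}}},$$ understood as a formal power series, i.e. as the $x$-adic limit of its finite truncations. *)

theory Defs
  imports
    "HOL-Computational_Algebra.Formal_Power_Series"
    "Jordan_Normal_Form.Determinant"
begin

definition somos4 ::
  "'a::field \<Rightarrow> 'a \<Rightarrow> 'a \<Rightarrow> 'a \<Rightarrow> 'a \<Rightarrow> (nat \<Rightarrow> 'a) \<Rightarrow> bool"
where
  "somos4 lam m r eta tau H \<longleftrightarrow>
     H 0 = 1 \<and> H 1 = lam \<and> H 2 = m \<and> H 3 = r \<and> H 4 = eta \<and>
     (\<forall>n\<ge>1. H (n + 4) * H n = H (n + 3) * H (n + 1) + tau * (H (n + 2))\<^sup>2)"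

(* Division is total here, with x / 0 = 0; that no denominator vanishes is a claim
   to be stated separately. The recurrences in the usual form, indexed by k, are
   stieltjes_coeff_even and stieltjes_coeff_odd below. *)
fun stieltjes_coeff ::
  "'a::field \<Rightarrow> 'a \<Rightarrow> 'a \<Rightarrow> 'a \<Rightarrow> 'a \<Rightarrow> nat \<Rightarrow> 'a"
where
  "stieltjes_coeff lam m r eta tau j =
     (if j = 0 then lam
      else if j = 1 then r / lam
      else if j = 2 then m / (lam * r)
      else if j = 3 then (lam * eta) / (m * r)
      else if j = 4 then r\<^sup>2 / (m * eta)
      else if j = 5 then (tau * m * r) / (lam * eta) + m\<^sup>2 / (lam * r)
      else if even j then
        1 / (stieltjes_coeff lam m r eta tau (j - 2) * stieltjes_coeff lam m r eta tau (j - 1))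
      else
        stieltjes_coeff lam m r eta tau (j - 3) + tau / stieltjes_coeff lam m r eta tau (j - 2))"

declare stieltjes_coeff.simps [simp del]

lemma stieltjes_coeff_even:
  assumes "k \<ge> 3"
  shows "stieltjes_coeff lam m r eta tau (2 * k) =
    1 / (stieltjes_coeff lam m r eta tau (2 * k - 2) * stieltjes_coeff lam m r eta tau (2 * k - 1))"
  using assms by (subst stieltjes_coeff.simps) simp

lemma stieltjes_coeff_odd:
  assumes "k \<ge> 3"
  shows "stieltjes_coeff lam m r eta tau (2 * k + 1) =
    stieltjes_coeff lam m r eta tau (2 * k - 2) + tau / stieltjes_coeff lam m r eta tau (2 * k - 1)"
proof -
  have "2 * k + 1 - 3 = 2 * k - 2" "2 * k + 1 - 2 = 2 * k - 1"
    using assms by simp_all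
  then show ?thesis
    using assms by (subst stieltjes_coeff.simps) simp
qed

(* stieltjes_trunc N c = c 0 / (1 - c 1 X / (1 - ... / (1 - c N X))) *)
primrec stieltjes_trunc :: "nat \<Rightarrow> (nat \<Rightarrow> 'a::field) \<Rightarrow> 'a fps" where
  "stieltjes_trunc 0 c = fps_const (c 0)"
| "stieltjes_trunc (Suc N) c =
     fps_const (c 0) / (1 - fps_X * stieltjes_trunc N (\<lambda>j. c (Suc j)))"

(* The limit is taken in the metric of the type fps, whose topology is the X-adic one. *)
definition stieltjes_fraction :: "(nat \<Rightarrow> 'a::field) \<Rightarrow> 'a fps" where
  "stieltjes_fraction c = lim (\<lambda>N. stieltjes_trunc N c)"

definition hankel_det :: "(nat \<Rightarrow> 'a::comm_ring_1) \<Rightarrow> nat \<Rightarrow> 'a" where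
  "hankel_det g n = det (mat n n (\<lambda>(i, j). g (i + j)))"

(* The field of rational functions over the rationals in five independent indeterminates. *)
type_synonym generic_field = "rat poly poly poly poly poly fract"

definition gen_lam :: generic_field where "gen_lam = to_fract [:0, 1:]"
definition gen_m :: generic_field where "gen_m = to_fract [:[:0, 1:]:]"
definition gen_r :: generic_field where "gen_r = to_fract [:[:[:0, 1:]:]:]"
definition gen_eta :: generic_field where "gen_eta = to_fract [:[:[:[:0, 1:]:]:]:]"
definition gen_tau :: generic_field where "gen_tau = to_fract [:[:[:[:[:0, 1:]:]:]:]:]"

end

theory Submission
  imports Defs
begin

text \<open>
  Two ideas carry the proof.

  The Hankel determinants of a Stieltjes fraction are products of its coefficients
  (\<open>hankel_det_stieltjes_fraction\<close>, \<open>shifted_hankel_det_stieltjes_fraction\<close>). If \<open>G\<close> is the fraction of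
  \<open>c\<close> and \<open>G'\<close> that of the shifted sequence \<open>c 1, c 2, ...\<close>, then \<open>G = c 0 + x G G'\<close>, and hence
    \<open>(G x - G y) / (x - y) = G x * G y * (x G' x - y G' y) / (x - y) / c 0\<close>,
    \<open>(x G x - y G y) / (x - y) = G x * G y * (1 + x y (G' x - G' y) / (x - y)) / c 0\<close>.
  The difference quotients generate the Hankel matrices of \<open>g (i + j + 1)\<close> and \<open>g (i + j)\<close>, and
  multiplication by \<open>G x * G y\<close> is a congruence by the triangular Toeplitz matrix of \<open>G\<close>. So passing
  from \<open>G\<close> to \<open>G'\<close> exchanges the two kinds of Hankel determinants, up to a power of \<open>c 0\<close>
  (\<open>hankel_det_shift_tail\<close>, \<open>hankel_det_tail\<close>), and the product formulas follow by induction.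

  In terms of the Somos sequence, the recurrences for the coefficients say
  \<open>c (2 n - 1) = H (n - 1) H (n + 2) / (H n H (n + 1))\<close> and \<open>c (2 n) = H (n + 1)^2 / (H n H (n + 2))\<close>:
  the even recurrence is then an identity, and the odd one is the Somos recurrence
  (\<open>somos4_stieltjes_coeff\<close>). With these values the partial products of \<open>c\<close> are quotients of
  consecutive terms of \<open>H\<close>, so that the product formulas telescope to \<open>H n\<close> and \<open>H (n + 2)\<close>.

  In the generic case no term vanishes because the field of rational functions has an ordering in
  which all five indeterminates are positive, and the recurrence involves no subtraction.
\<close>

section \<open>Convergence of Stieltjes fractions\<close>

lemma stieltjes_trunc_nth_0: "fps_nth (stieltjes_trunc N c) 0 = c 0"
  by (cases N) (simp_all add: fps_divide_unit)

lemma stieltjes_trunc_Suc_eq: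
  "stieltjes_trunc (Suc N) c =
     fps_const (c 0) + fps_X * (stieltjes_trunc (Suc N) c * stieltjes_trunc N (\<lambda>j. c (Suc j)))"
proof -
  let ?d = "1 - fps_X * stieltjes_trunc N (\<lambda>j. c (Suc j))"
  have "stieltjes_trunc (Suc N) c * ?d = fps_const (c 0) * (inverse ?d * ?d)"
    by (simp add: fps_divide_unit mult.assoc)
  also have "inverse ?d * ?d = 1"
    by (rule inverse_mult_eq_1) simp
  finally show ?thesis
    by (simp add: algebra_simps)
qed

lemma stieltjes_trunc_nth_Suc:
  "fps_nth (stieltjes_trunc (Suc N) c) (Suc n) =
     (\<Sum>i\<le>n. fps_nth (stieltjes_trunc (Suc N) c) i *
              fps_nth (stieltjes_trunc N (\<lambda>j. c (Suc j))) (n - i))"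
proof -
  let ?T = "stieltjes_trunc (Suc N) c" and ?T' = "stieltjes_trunc N (\<lambda>j. c (Suc j))"
  have "fps_nth ?T (Suc n) = fps_nth (fps_const (c 0) + fps_X * (?T * ?T')) (Suc n)"
    by (rule arg_cong[OF stieltjes_trunc_Suc_eq])
  also have "\<dots> = fps_nth (?T * ?T') n"
    by (simp del: stieltjes_trunc.simps)
  finally show ?thesis
    by (simp only: fps_mult_nth atLeast0AtMost)
qed

lemma stieltjes_trunc_nth_stable:
  assumes "n \<le> N" "n \<le> M"
  shows "fps_nth (stieltjes_trunc N c) n = fps_nth (stieltjes_trunc M c) n"
  using assms
proof (induction n arbitrary: N M c rule: less_induct)
  case (less n)
  show ?case
  proof (cases n)
    case 0
    then show ?thesis by (simp add: stieltjes_trunc_nth_0)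
  next
    case (Suc n')
    obtain N' M' where [simp]: "N = Suc N'" "M = Suc M'" and "n' \<le> N'" "n' \<le> M'"
      using less.prems Suc by (metis Suc_le_D Suc_le_mono)
    then show ?thesis
      unfolding Suc \<open>N = _\<close> \<open>M = _\<close> stieltjes_trunc_nth_Suc
      by (intro sum.cong refl arg_cong2[of _ _ _ _ "(*)"] less.IH) (simp_all add: Suc)
  qed
qed

lemma stieltjes_trunc_LIMSEQ: "(\<lambda>N. stieltjes_trunc N c) \<longlonglongrightarrow> stieltjes_fraction c"
proof -
  have "(\<lambda>N. stieltjes_trunc N c) \<longlonglongrightarrow> Abs_fps (\<lambda>n. fps_nth (stieltjes_trunc n c) n)"
  proof (rule tendsto_fpsI)
    fix n
    show "\<forall>\<^sub>F N in sequentially.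
            fps_nth (stieltjes_trunc N c) n =
            fps_nth (Abs_fps (\<lambda>n. fps_nth (stieltjes_trunc n c) n)) n"
      using eventually_ge_at_top[of n]
      by eventually_elim (simp, rule stieltjes_trunc_nth_stable, simp_all)
  qed
  then show ?thesis
    unfolding stieltjes_fraction_def by (metis limI)
qed

lemma stieltjes_fraction_nth:
  assumes "n \<le> N"
  shows "fps_nth (stieltjes_fraction c) n = fps_nth (stieltjes_trunc N c) n"
proof -
  have "\<forall>\<^sub>F M in sequentially. fps_nth (stieltjes_trunc M c) n = fps_nth (stieltjes_fraction c) n"
    using stieltjes_trunc_LIMSEQ[of c] by (simp add: tendsto_fps_iff)
  then obtain M0 where
    "\<And>M. M \<ge> M0 \<Longrightarrow> fps_nth (stieltjes_trunc M c) n = fps_nth (stieltjes_fraction c) n"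
    by (auto simp: eventually_sequentially)
  then have "fps_nth (stieltjes_trunc (max M0 n) c) n = fps_nth (stieltjes_fraction c) n"
    by simp
  then show ?thesis
    using stieltjes_trunc_nth_stable[of n N "max M0 n" c] assms by simp
qed

lemma stieltjes_fraction_nth_0: "fps_nth (stieltjes_fraction c) 0 = c 0"
  by (simp add: stieltjes_fraction_nth[of 0 0])

text \<open>
  This is \<open>G = c 0 + x G G'\<close> beyond the constant term. With the nonvanishing of the constant
  term it is all that the determinant evaluations below use about the fraction.
\<close>
lemma stieltjes_fraction_nth_Suc:
  "fps_nth (stieltjes_fraction c) (Suc n) =
     (\<Sum>i\<le>n. fps_nth (stieltjes_fraction c) i *
              fps_nth (stieltjes_fraction (\<lambda>j. c (Suc j))) (n - i))"
  by (simp add: stieltjes_fraction_nth[where N = "Suc n" and c = c]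
      stieltjes_fraction_nth[where N = n and c = "\<lambda>j. c (Suc j)"]
      stieltjes_trunc_nth_Suc del: stieltjes_trunc.simps)

section \<open>Hankel determinants of a fraction and of its tail\<close>

text \<open>
  The matrix on the left is \<open>L B L\<^sup>T\<close> with \<open>L\<close> the lower triangular Toeplitz matrix of \<open>u\<close>; on
  generating functions this is the multiplication by \<open>U x * U y\<close>.
\<close>
lemma det_toeplitz_congruence:
  fixes u :: "nat \<Rightarrow> 'a::idom"
  shows "det (mat n n (\<lambda>(i, j). \<Sum>a\<le>i. \<Sum>b\<le>j. u (i - a) * u (j - b) * B a b)) =
         u 0 ^ n * u 0 ^ n * det (mat n n (\<lambda>(i, j). B i j))"
proof -
  let ?t = "\<lambda>i a. if a \<le> i then u (i - a) else 0"
  define L where "L = mat n n (\<lambda>(i, a). ?t i a)"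
  define M where "M = mat n n (\<lambda>(i, j). B i j)"
  have carr: "L \<in> carrier_mat n n" "M \<in> carrier_mat n n" "L\<^sup>T \<in> carrier_mat n n"
    by (simp_all add: L_def M_def)
  have restrict: "(\<Sum>a<n. ?t i a * f a) = (\<Sum>a\<le>i. u (i - a) * f a)"
    if "i < n" for i and f :: "nat \<Rightarrow> 'a"
    using that by (intro sum.mono_neutral_cong_right) auto
  have "mat n n (\<lambda>(i, j). \<Sum>a\<le>i. \<Sum>b\<le>j. u (i - a) * u (j - b) * B a b) =
        L * (M * L\<^sup>T)"
  proof (rule eq_matI)
    fix i j assume "i < dim_row (L * (M * L\<^sup>T))" "j < dim_col (L * (M * L\<^sup>T))"
    then have ij: "i < n" "j < n"
      by (simp_all add: L_def)
    have entry: "(P * Q) $$ (i, j) = (\<Sum>a<n. P $$ (i, a) * Q $$ (a, j))"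
      if "P \<in> carrier_mat n n" "Q \<in> carrier_mat n n" "i < n" "j < n" for P Q :: "'a mat" and i j
      using that by (auto simp: scalar_prod_def lessThan_atLeast0)
    have "(L * (M * L\<^sup>T)) $$ (i, j) =
          (\<Sum>a<n. L $$ (i, a) * (\<Sum>b<n. M $$ (a, b) * L\<^sup>T $$ (b, j)))"
      using ij
      by (auto simp: entry[OF carr(1) mult_carrier_mat[OF carr(2,3)] ij] entry[OF carr(2,3)]
          simp del: index_mult_mat(1) intro!: sum.cong)
    also have "\<dots> = (\<Sum>a<n. ?t i a * (\<Sum>b<n. ?t j b * B a b))"
      using ij
      by - (intro sum.cong refl, rule arg_cong2[of _ _ _ _ "(*)"],
          auto simp: L_def M_def intro!: sum.cong)
    also have "\<dots> = (\<Sum>a\<le>i. u (i - a) * (\<Sum>b\<le>j. u (j - b) * B a b))"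
      using ij by (simp only: restrict)
    finally show "mat n n (\<lambda>(i, j). \<Sum>a\<le>i. \<Sum>b\<le>j. u (i - a) * u (j - b) * B a b) $$ (i, j) =
        (L * (M * L\<^sup>T)) $$ (i, j)"
      using ij by (simp add: sum_distrib_left mult.assoc)
  qed (simp_all add: L_def M_def)
  moreover have "det L = u 0 ^ n"
    using det_lower_triangular[OF _ carr(1)] by (simp add: L_def prod_list_diag_prod)
  ultimately show ?thesis
    by (simp add: det_mult[OF carr(1) mult_carrier_mat[OF carr(2,3)]] det_mult[OF carr(2,3)]
        det_transpose[OF carr(1)] M_def[symmetric] mult_ac)
qed

lemma convolution_flip:
  fixes u v :: "nat \<Rightarrow> 'a::comm_ring_1"
  assumes "\<And>n. u (Suc n) = (\<Sum>i\<le>n. u i * v (n - i))"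
  shows "(\<Sum>i\<le>n. u (n - i) * v i) = u (Suc n)"
  using sum.atLeastAtMost_rev[of "\<lambda>i. u (n - i) * v i" 0 n]
  by (simp add: assms atLeast0AtMost)

text \<open>
  The first of the two generating function identities,
  \<open>u 0 * (U x - U y) / (x - y) = U x * U y * (x V x - y V y) / (x - y)\<close> where \<open>U = u 0 + x U V\<close>.
  The right-hand side below depends on \<open>i + j\<close> only, so the induction moves one unit from \<open>j\<close> to \<open>i\<close>. Splitting off
  the terms with \<open>b = 0\<close> on the one hand and \<open>a = 0\<close> on the other leaves the same double sum.
\<close>
lemma convolution_shift:
  fixes u v :: "nat \<Rightarrow> 'a::comm_ring_1"
  assumes u: "\<And>n. u (Suc n) = (\<Sum>i\<le>n. u i * v (n - i))"
  shows "(\<Sum>a\<le>i. \<Sum>b\<le>j. u (i - a) * u (j - b) * v (a + b)) = u 0 * u (i + j + 1)"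
proof (induction j arbitrary: i)
  case 0
  then show ?case
    by (simp add: convolution_flip[of u v, OF u, symmetric] sum_distrib_left mult_ac)
next
  case (Suc j)
  define S where "S = (\<Sum>a\<le>i. \<Sum>b\<le>j. u (i - a) * u (j - b) * v (a + b + 1))"
  have "(\<Sum>a\<le>i. \<Sum>b\<le>Suc j. u (i - a) * u (Suc j - b) * v (a + b)) =
        u (Suc j) * (\<Sum>a\<le>i. u (i - a) * v a) + S"
    by (simp add: S_def sum.atMost_Suc_shift sum.distrib sum_distrib_left mult_ac del: sum.atMost_Suc)
  also have "\<dots> = u (Suc i) * (\<Sum>b\<le>j. u (j - b) * v b) + S"
    unfolding convolution_flip[of u v, OF u] by (simp only: mult.commute)
  also have "\<dots> = (\<Sum>a\<le>Suc i. \<Sum>b\<le>j. u (Suc i - a) * u (j - b) * v (a + b))"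
    by (simp add: S_def sum.atMost_Suc_shift sum.distrib sum_distrib_left mult_ac del: sum.atMost_Suc)
  also have "\<dots> = u 0 * u (i + Suc j + 1)"
    by (simp add: Suc.IH)
  finally show ?case .
qed

lemma hankel_det_smult:
  "det (mat n n (\<lambda>(i, j). k * g (i + j))) = k ^ n * hankel_det g n"
proof -
  have "mat n n (\<lambda>(i, j). k * g (i + j)) = k \<cdot>\<^sub>m mat n n (\<lambda>(i, j). g (i + j))"
    by (rule eq_matI) auto
  then show ?thesis
    by (simp add: hankel_det_def)
qed

lemma hankel_det_shift_tail:
  fixes u v :: "nat \<Rightarrow> 'a::idom"
  assumes u: "\<And>n. u (Suc n) = (\<Sum>i\<le>n. u i * v (n - i))" and "u 0 \<noteq> 0"
  shows "hankel_det (\<lambda>i. u (i + 1)) n = u 0 ^ n * hankel_det v n"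
proof -
  have "u 0 ^ n * hankel_det (\<lambda>i. u (i + 1)) n =
        det (mat n n (\<lambda>(i, j). \<Sum>a\<le>i. \<Sum>b\<le>j. u (i - a) * u (j - b) * v (a + b)))"
    by (simp add: convolution_shift[of u v, OF u] hankel_det_smult[symmetric])
  also have "\<dots> = u 0 ^ n * (u 0 ^ n * hankel_det v n)"
    by (subst det_toeplitz_congruence) (simp add: hankel_det_def)
  finally show ?thesis
    using assms(2) by simp
qed

text \<open>
  For the unshifted Hankel matrix of \<open>u\<close> the congruence leads to the block diagonal matrix of 1 and
  the shifted Hankel matrix of \<open>v\<close>. The border \<open>a = 0\<close>, \<open>b = 0\<close> contributes \<open>u i * u j\<close>, which for
  \<open>i, j > 0\<close> is the part of the preceding identity at \<open>(i - 1, j)\<close> that splits off there.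
\<close>
lemma hankel_det_tail:
  fixes u v :: "nat \<Rightarrow> 'a::idom"
  assumes u: "\<And>n. u (Suc n) = (\<Sum>i\<le>n. u i * v (n - i))" and "u 0 \<noteq> 0"
  shows "hankel_det u (Suc n) = u 0 ^ Suc n * hankel_det (\<lambda>i. v (i + 1)) n"
proof -
  define B where "B a b = (if a = 0 \<and> b = 0 then 1 else if a = 0 \<or> b = 0 then 0 else v (a + b - 1))"
    for a b :: nat
  have B0: "B 0 (Suc b) = 0" "B (Suc a) 0 = 0" "B 0 0 = 1" "B (Suc a) (Suc b) = v (a + b + 1)" for a b
    by (simp_all add: B_def)
  have conv: "(\<Sum>a\<le>i. \<Sum>b\<le>j. u (i - a) * u (j - b) * B a b) = u 0 * u (i + j)" for i j
  proof (cases i; cases j)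
    fix i' j' assume [simp]: "i = Suc i'" "j = Suc j'"
    define S where "S = (\<Sum>a\<le>i'. \<Sum>b\<le>j'. u (i' - a) * u (j' - b) * v (a + b + 1))"
    have "(\<Sum>a\<le>i. \<Sum>b\<le>j. u (i - a) * u (j - b) * B a b) = u i * u j + S"
      by (simp add: S_def sum.atMost_Suc_shift B0 sum.distrib del: sum.atMost_Suc)
    also have "\<dots> = u j * (\<Sum>a\<le>i'. u (i' - a) * v a) + S"
      unfolding convolution_flip[of u v, OF u] by (simp add: mult.commute)
    also have "\<dots> = (\<Sum>a\<le>i'. \<Sum>b\<le>Suc j'. u (i' - a) * u (Suc j' - b) * v (a + b))"
      by (simp add: S_def sum.atMost_Suc_shift sum.distrib sum_distrib_left mult_ac del: sum.atMost_Suc)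
    also have "\<dots> = u 0 * u (i + j)"
      by (simp add: convolution_shift[of u v, OF u] del: sum.atMost_Suc)
    finally show ?thesis .
  qed (simp_all add: sum.atMost_Suc_shift B0 mult.commute del: sum.atMost_Suc)
  have block: "mat (Suc n) (Suc n) (\<lambda>(i, j). B i j) =
      four_block_mat (1\<^sub>m 1) (0\<^sub>m 1 n) (0\<^sub>m n 1) (mat n n (\<lambda>(i, j). v (i + j + 1)))"
    by (rule eq_matI) (auto simp: B_def)
  have "det (mat (Suc n) (Suc n) (\<lambda>(i, j). B i j)) = hankel_det (\<lambda>i. v (i + 1)) n"
    unfolding block
    by (subst det_four_block_mat_lower_left_zero[of _ 1 _ n]) (auto simp: hankel_det_def)
  moreover have "u 0 ^ Suc n * hankel_det u (Suc n) =
      u 0 ^ Suc n * u 0 ^ Suc n * det (mat (Suc n) (Suc n) (\<lambda>(i, j). B i j))"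
    by (simp only: hankel_det_smult[symmetric] conv[symmetric] det_toeplitz_congruence)
  ultimately show ?thesis
    using assms(2) by (simp add: mult.assoc)
qed

lemma hankel_det_0 [simp]: "hankel_det g 0 = 1"
  by (simp add: hankel_det_def)

theorem hankel_det_stieltjes_fraction:
  assumes "\<And>j. c j \<noteq> 0"
  shows "hankel_det (fps_nth (stieltjes_fraction c)) n = (\<Prod>i<n. \<Prod>k\<le>2 * i. c k)"
  using assms
proof (induction n arbitrary: c)
  case 0
  then show ?case by simp
next
  case (Suc n)
  let ?G = "\<lambda>d. fps_nth (stieltjes_fraction d)"
  let ?c1 = "\<lambda>j. c (Suc j)" and ?c2 = "\<lambda>j. c (Suc (Suc j))"
  have "hankel_det (?G c) (Suc n) = c 0 ^ Suc n * hankel_det (\<lambda>i. ?G ?c1 (i + 1)) n"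
    using hankel_det_tail[of "?G c" "?G ?c1" n] Suc.prems
    by (simp add: stieltjes_fraction_nth_Suc stieltjes_fraction_nth_0)
  also have "hankel_det (\<lambda>i. ?G ?c1 (i + 1)) n = c 1 ^ n * hankel_det (?G ?c2) n"
    using hankel_det_shift_tail[of "?G ?c1" "?G ?c2" n] Suc.prems
    by (simp add: stieltjes_fraction_nth_Suc stieltjes_fraction_nth_0)
  also have "hankel_det (?G ?c2) n = (\<Prod>i<n. \<Prod>k\<le>2 * i. ?c2 k)"
    using Suc by simp
  also have "c 0 ^ Suc n * (c 1 ^ n * (\<Prod>i<n. \<Prod>k\<le>2 * i. ?c2 k)) =
      (\<Prod>i<Suc n. \<Prod>k\<le>2 * i. c k)"
    by (simp add: prod.lessThan_Suc_shift prod.atMost_Suc_shift prod.distrib mult_ac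
        del: prod.lessThan_Suc prod.atMost_Suc)
  finally show ?case .
qed

theorem shifted_hankel_det_stieltjes_fraction:
  assumes "\<And>j. c j \<noteq> 0"
  shows "hankel_det (\<lambda>i. fps_nth (stieltjes_fraction c) (i + 1)) n =
         (\<Prod>i<n. \<Prod>k\<le>2 * i + 1. c k)"
proof -
  let ?c1 = "\<lambda>j. c (Suc j)"
  have "hankel_det (\<lambda>i. fps_nth (stieltjes_fraction c) (i + 1)) n =
        c 0 ^ n * hankel_det (fps_nth (stieltjes_fraction ?c1)) n"
    using hankel_det_shift_tail[of "fps_nth (stieltjes_fraction c)" "fps_nth (stieltjes_fraction ?c1)" n]
      assms
    by (simp add: stieltjes_fraction_nth_Suc stieltjes_fraction_nth_0)
  also have "\<dots> = c 0 ^ n * (\<Prod>i<n. \<Prod>k\<le>2 * i. ?c1 k)"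
    using hankel_det_stieltjes_fraction[of ?c1 n] assms by simp
  also have "\<dots> = (\<Prod>i<n. \<Prod>k\<le>2 * i + 1. c k)"
    by (simp add: prod.atMost_Suc_shift prod.distrib del: prod.atMost_Suc)
  finally show ?thesis .
qed

section \<open>The coefficients in terms of the Somos sequence\<close>

lemma somos4_unique:
  assumes "somos4 lam m r eta tau H" "\<And>n. n \<ge> 1 \<Longrightarrow> H n \<noteq> 0" "somos4 lam m r eta tau H'"
  shows "H' = H"
proof
  fix n
  show "H' n = H n"
  proof (induction n rule: less_induct)
    case (less n)
    show ?case
    proof (cases "n \<ge> 5")
      case True
      define k where "k = n - 4"
      have k: "k \<ge> 1" "n = k + 4"
        using True by (simp_all add: k_def)
      have "H' (k + 4) * H' k = H' (k + 3) * H' (k + 1) + tau * (H' (k + 2))\<^sup>2"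
        using assms(3) k by (simp add: somos4_def)
      moreover have "H (k + 4) * H k = H (k + 3) * H (k + 1) + tau * (H (k + 2))\<^sup>2"
        using assms(1) k by (simp add: somos4_def)
      moreover have "H' k = H k" "H' (k + 1) = H (k + 1)" "H' (k + 2) = H (k + 2)" "H' (k + 3) = H (k + 3)"
        using less.IH k by simp_all
      ultimately show ?thesis
        using assms(2)[of k] k by (metis mult_right_cancel)
    next
      case False
      then have "n = 0 \<or> n = 1 \<or> n = 2 \<or> n = 3 \<or> n = 4"
        by linarith
      then show ?thesis
        using assms(1,3) by (auto simp: somos4_def)
    qed
  qed
qed

lemma stieltjes_coeff_init:
  "stieltjes_coeff lam m r eta tau 0 = lam"
  "stieltjes_coeff lam m r eta tau (Suc 0) = r / lam"
  "stieltjes_coeff lam m r eta tau 2 = m / (lam * r)"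
  "stieltjes_coeff lam m r eta tau 3 = (lam * eta) / (m * r)"
  "stieltjes_coeff lam m r eta tau 4 = r\<^sup>2 / (m * eta)"
  "stieltjes_coeff lam m r eta tau 5 = (tau * m * r) / (lam * eta) + m\<^sup>2 / (lam * r)"
  by (subst stieltjes_coeff.simps, simp)+

lemma somos4_stieltjes_coeff:
  fixes H :: "nat \<Rightarrow> 'a::field"
  assumes H: "somos4 lam m r eta tau H" and nz: "\<And>n. n \<ge> 1 \<Longrightarrow> H n \<noteq> 0" and "n \<ge> 2"
  defines "c \<equiv> stieltjes_coeff lam m r eta tau"
  shows "c (2 * n - 1) = (H (n - 1) * H (n + 2)) / (H n * H (n + 1)) \<and>
         c (2 * n) = (H (n + 1))\<^sup>2 / (H n * H (n + 2))"
  using \<open>n \<ge> 2\<close>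
proof (induction n rule: nat_induct_at_least)
  case base
  show ?case
    using H
    by (simp add: somos4_def c_def stieltjes_coeff_init numeral_3_eq_3[symmetric])
next
  case (Suc n)
  define h0 h1 h2 h3 h4 where h: "h0 = H (n - 1)" "h1 = H n" "h2 = H (n + 1)" "h3 = H (n + 2)" "h4 = H (n + 3)"
  have hnz: "h0 \<noteq> 0" "h1 \<noteq> 0" "h2 \<noteq> 0" "h3 \<noteq> 0" "h4 \<noteq> 0"
    using nz Suc.hyps by (simp_all add: h)
  have rec: "h4 * h0 = h3 * h1 + tau * h2\<^sup>2"
  proof -
    have "1 \<le> n - 1"
      using Suc.hyps by simp
    then have "H (n - 1 + 4) * H (n - 1) =
          H (n - 1 + 3) * H (n - 1 + 1) + tau * (H (n - 1 + 2))\<^sup>2"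
      using H unfolding somos4_def by blast
    moreover have "n - 1 + 4 = n + 3" "n - 1 + 3 = n + 2" "n - 1 + 2 = n + 1" "n - 1 + 1 = n"
      using Suc.hyps by simp_all
    ultimately show ?thesis by (simp only: h)
  qed
  then have h4: "h4 = (h3 * h1 + tau * h2\<^sup>2) / h0"
    using hnz by (simp add: field_simps)
  have odd_n: "c (2 * n - 1) = (h0 * h3) / (h1 * h2)" and even_n: "c (2 * n) = h2\<^sup>2 / (h1 * h3)"
    using Suc.IH by (simp_all add: h)
  have odd: "c (2 * n + 1) = (h1 * h4) / (h2 * h3)"
  proof (cases "n = 2")
    case True
    have "h0 = lam" "h1 = m" "h2 = r" "h3 = eta"
      using H True by (simp_all add: h somos4_def numeral_3_eq_3[symmetric])
    then have "c 5 = (tau * h1 * h2) / (h0 * h3) + h1\<^sup>2 / (h0 * h2)"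
      by (simp add: c_def stieltjes_coeff_init)
    also have "\<dots> = h1 * ((h3 * h1 + tau * h2\<^sup>2) / h0) / (h2 * h3)"
      using hnz by (simp add: field_simps power2_eq_square)
    finally show ?thesis
      using True h4 by simp
  next
    case False
    have "c (2 * n + 1) = c (2 * n - 2) + tau / c (2 * n - 1)"
      using stieltjes_coeff_odd[of n lam m r eta tau] False Suc.hyps by (simp add: c_def)
    \<comment> \<open>The even recurrence read backwards, which spares a second induction hypothesis.\<close>
    moreover have "c (2 * n - 2) = h1\<^sup>2 / (h0 * h2)"
    proof -
      have "c (2 * n) = 1 / (c (2 * n - 2) * c (2 * n - 1))"
        using stieltjes_coeff_even[of n lam m r eta tau] False Suc.hyps by (simp add: c_def)
      moreover have "c (2 * n) \<noteq> 0" "c (2 * n - 1) \<noteq> 0"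
        using odd_n even_n hnz by simp_all
      ultimately have "c (2 * n - 2) = 1 / (c (2 * n) * c (2 * n - 1))"
        by (simp del: One_nat_def)
      also have "\<dots> = h1\<^sup>2 / (h0 * h2)"
        unfolding odd_n even_n using hnz by (simp add: field_simps power2_eq_square)
      finally show ?thesis .
    qed
    ultimately have "c (2 * n + 1) = h1\<^sup>2 / (h0 * h2) + tau / ((h0 * h3) / (h1 * h2))"
      using odd_n by simp
    also have "\<dots> = h1 * ((h3 * h1 + tau * h2\<^sup>2) / h0) / (h2 * h3)"
      using hnz by (simp add: field_simps power2_eq_square)
    finally show ?thesis
      using h4 by simp
  qed
  have "c (2 * Suc n) = 1 / (c (2 * n) * c (2 * n + 1))"
    using stieltjes_coeff_even[of "Suc n" lam m r eta tau] Suc.hyps by (simp add: c_def)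
  also have "\<dots> = h3\<^sup>2 / (h2 * h4)"
    unfolding odd even_n using hnz by (simp add: field_simps power2_eq_square)
  finally have "c (2 * Suc n) = h3\<^sup>2 / (h2 * h4)" .
  then show ?case
    using odd by (simp add: h numeral_3_eq_3)
qed

lemma somos4_stieltjes_coeff_nonzero:
  assumes H: "somos4 lam m r eta tau H" and nz: "\<And>n. n \<ge> 1 \<Longrightarrow> H n \<noteq> 0"
  shows "stieltjes_coeff lam m r eta tau j \<noteq> 0"
proof (cases "j \<ge> 3")
  case True
  then have n: "(j + 1) div 2 \<ge> 2" and j: "j = 2 * ((j + 1) div 2) - 1 \<or> j = 2 * ((j + 1) div 2)"
    by linarith+
  from j show ?thesis
    using somos4_stieltjes_coeff[OF assms n] nz n by auto
next
  case False
  then have "j = 0 \<or> j = 1 \<or> j = 2"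
    by linarith
  moreover have "lam \<noteq> 0" "m \<noteq> 0" "r \<noteq> 0"
    using H nz[of 1] nz[of 2] nz[of 3] by (auto simp: somos4_def)
  ultimately show ?thesis
    by (auto simp: stieltjes_coeff_init)
qed

text \<open>
  The two products telescope: \<open>c (2 i + 1) * c (2 i + 2) = H i * H (i + 2) / H (i + 1)^2\<close> is the
  quotient of two consecutive values of \<open>H (i + 1) / H i\<close>. This includes \<open>i = 0\<close>, because
  \<open>H 0 = 1\<close>.
\<close>
lemma prod_stieltjes_coeff_even:
  assumes H: "somos4 lam m r eta tau H" and nz: "\<And>n. n \<ge> 1 \<Longrightarrow> H n \<noteq> 0"
  shows "(\<Prod>k\<le>2 * i. stieltjes_coeff lam m r eta tau k) = H (i + 1) / H i"
proof (induction i)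
  case 0
  show ?case
    using H by (simp add: somos4_def stieltjes_coeff_init)
next
  case (Suc i)
  let ?c = "stieltjes_coeff lam m r eta tau"
  have nz0: "H k \<noteq> 0" for k
    using H nz[of k] by (cases k) (auto simp: somos4_def)
  have step: "?c (2 * i + 1) * ?c (2 * i + 2) = H i * H (i + 2) / (H (i + 1))\<^sup>2"
  proof (cases i)
    case 0
    then show ?thesis
      using H nz[of 1] nz[of 3]
      by (simp add: somos4_def stieltjes_coeff_init
          numeral_2_eq_2[symmetric] power2_eq_square)
  next
    case (Suc k)
    then have "i + 1 \<ge> 2"
      by simp
    from somos4_stieltjes_coeff[OF assms this]
    have "?c (2 * i + 1) = H i * H (i + 3) / (H (i + 1) * H (i + 2))"
      and "?c (2 * i + 2) = (H (i + 2))\<^sup>2 / (H (i + 1) * H (i + 3))"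
      by (simp_all add: numeral_3_eq_3)
    then have "?c (2 * i + 1) * ?c (2 * i + 2) =
        H i * H (i + 3) / (H (i + 1) * H (i + 2)) * ((H (i + 2))\<^sup>2 / (H (i + 1) * H (i + 3)))"
      by simp
    also have "\<dots> = H i * H (i + 2) / (H (i + 1))\<^sup>2"
      using nz0[of "i + 1"] nz0[of "i + 2"] nz0[of "i + 3"]
      by (simp add: field_simps power2_eq_square)
    finally show ?thesis .
  qed
  have "(\<Prod>k\<le>2 * Suc i. ?c k) = (\<Prod>k\<le>2 * i. ?c k) * (?c (2 * i + 1) * ?c (2 * i + 2))"
    by (simp add: mult.assoc)
  also have "\<dots> = H (i + 1) / H i * (H i * H (i + 2) / (H (i + 1))\<^sup>2)"
    by (simp only: Suc.IH step)
  also have "\<dots> = H (Suc i + 1) / H (Suc i)"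
    using nz0[of i] nz0[of "i + 1"] by (simp add: field_simps power2_eq_square)
  finally show ?case .
qed

text \<open>
  The right-hand side is the quotient of two consecutive values of the sequence \<open>1, H 3, H 4, ...\<close>.
  That this sequence starts with 1 and not with \<open>H 2\<close> is why \<open>i = 0\<close> is exceptional.
\<close>
lemma prod_stieltjes_coeff_odd:
  assumes H: "somos4 lam m r eta tau H" and nz: "\<And>n. n \<ge> 1 \<Longrightarrow> H n \<noteq> 0"
  shows "(\<Prod>k\<le>2 * i + 1. stieltjes_coeff lam m r eta tau k) =
         H (i + 3) / (if i = 0 then 1 else H (i + 2))"
proof (cases i)
  case 0
  then show ?thesis
    using H nz[of 1] by (simp add: somos4_def stieltjes_coeff_init)
next
  case (Suc k)
  have "(\<Prod>k\<le>2 * i + 1. stieltjes_coeff lam m r eta tau k) =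
        H (i + 1) / H i * stieltjes_coeff lam m r eta tau (2 * i + 1)"
    using prod_stieltjes_coeff_even[OF assms, of i] by simp
  then show ?thesis
    using somos4_stieltjes_coeff[OF assms, of "i + 1"] Suc nz[of i] nz[of "i + 1"]
    by (simp add: numeral_3_eq_3)
qed

lemma hankel_det_somos4:
  assumes H: "somos4 lam m r eta tau H" and nz: "\<And>n. n \<ge> 1 \<Longrightarrow> H n \<noteq> 0"
  shows "hankel_det (fps_nth (stieltjes_fraction (stieltjes_coeff lam m r eta tau))) n = H n"
proof -
  have "(\<Prod>i<n. H (i + 1) / H i) = H n"
  proof (induction n)
    case 0
    show ?case using H by (simp add: somos4_def)
  next
    case (Suc n)
    have "H n \<noteq> 0"
      using H nz[of n] by (cases n) (auto simp: somos4_def)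
    with Suc show ?case by simp
  qed
  then show ?thesis
    by (simp add: hankel_det_stieltjes_fraction somos4_stieltjes_coeff_nonzero[OF assms]
        prod_stieltjes_coeff_even[OF assms] del: One_nat_def)
qed

lemma shifted_hankel_det_somos4:
  assumes H: "somos4 lam m r eta tau H" and nz: "\<And>n. n \<ge> 1 \<Longrightarrow> H n \<noteq> 0" and "n \<ge> 1"
  shows "hankel_det (\<lambda>i. fps_nth (stieltjes_fraction (stieltjes_coeff lam m r eta tau)) (i + 1)) n =
         H (n + 2)"
proof -
  have "(\<Prod>i<n. H (i + 3) / (if i = 0 then 1 else H (i + 2))) = H (n + 2)"
    using \<open>n \<ge> 1\<close>
  proof (induction n rule: nat_induct_at_least)
    case base
    show ?case by (simp add: numeral_3_eq_3)
  next
    case (Suc n)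
    with nz[of "n + 2"] show ?case by (simp add: numeral_3_eq_3)
  qed
  then show ?thesis
    using shifted_hankel_det_stieltjes_fraction[of "stieltjes_coeff lam m r eta tau" n]
      somos4_stieltjes_coeff_nonzero[OF assms(1,2)]
    by (simp add: prod_stieltjes_coeff_odd[OF assms(1,2)] del: One_nat_def prod.atMost_Suc)
qed

section \<open>The generic Somos sequence\<close>

fun somos4_seq :: "'a::field \<Rightarrow> 'a \<Rightarrow> 'a \<Rightarrow> 'a \<Rightarrow> 'a \<Rightarrow> nat \<Rightarrow> 'a" where
  "somos4_seq lam m r eta tau n =
     (if n < 5 then [1, lam, m, r, eta] ! n
      else (somos4_seq lam m r eta tau (n - 1) * somos4_seq lam m r eta tau (n - 3) +
            tau * (somos4_seq lam m r eta tau (n - 2))\<^sup>2) / somos4_seq lam m r eta tau (n - 4))"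

declare somos4_seq.simps [simp del]

lemma somos4_seq_pos:
  fixes lam :: "'a::linordered_field"
  assumes "lam > 0" "m > 0" "r > 0" "eta > 0" "tau > 0"
  shows "somos4_seq lam m r eta tau n > 0"
proof (induction n rule: less_induct)
  case (less n)
  show ?case
  proof (cases "n < 5")
    case True
    then have "n = 0 \<or> n = 1 \<or> n = 2 \<or> n = 3 \<or> n = 4"
      by linarith
    then show ?thesis
      using assms by (subst somos4_seq.simps) auto
  next
    case False
    then show ?thesis
      using assms
      by (subst somos4_seq.simps, simp only: if_False)
        (intro divide_pos_pos add_pos_pos mult_pos_pos zero_less_power less.IH, auto)
  qed
qed

lemma somos4_somos4_seq:
  assumes "\<And>n. somos4_seq lam m r eta tau n \<noteq> 0"
  shows "somos4 lam m r eta tau (somos4_seq lam m r eta tau)"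
proof -
  have "somos4_seq lam m r eta tau (n + 4) * somos4_seq lam m r eta tau n =
        somos4_seq lam m r eta tau (n + 3) * somos4_seq lam m r eta tau (n + 1) +
        tau * (somos4_seq lam m r eta tau (n + 2))\<^sup>2" if "n \<ge> 1" for n
  proof -
    have "n + 4 - 1 = n + 3" "n + 4 - 2 = n + 2" "n + 4 - 3 = n + 1" "n + 4 - 4 = n" "\<not> n + 4 < 5"
      using that by simp_all
    then have "somos4_seq lam m r eta tau (n + 4) =
        (somos4_seq lam m r eta tau (n + 3) * somos4_seq lam m r eta tau (n + 1) +
          tau * (somos4_seq lam m r eta tau (n + 2))\<^sup>2) / somos4_seq lam m r eta tau n"
      by (subst somos4_seq.simps) (simp only: if_False)
    then show ?thesis
      using assms[of n] by simp
  qed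
  then show ?thesis
    by (simp add: somos4_def somos4_seq.simps[of _ _ _ _ _ 0] somos4_seq.simps[of _ _ _ _ _ "Suc 0"]
        somos4_seq.simps[of _ _ _ _ _ 1] somos4_seq.simps[of _ _ _ _ _ 2]
        somos4_seq.simps[of _ _ _ _ _ 3] somos4_seq.simps[of _ _ _ _ _ 4])
qed

lemma to_fract_pos_iff: "to_fract p > 0 \<longleftrightarrow> p > 0"
  for p :: "'a::linordered_idom"
  by (simp add: to_fract_def zero_less_Fract_iff)

lemma pos_poly_1: "pos_poly (1 :: 'a::linordered_idom poly)"
  by (simp add: pos_poly_def)

text \<open>A polynomial is positive iff its leading coefficient is, recursively in the variables.\<close>
lemma generic_parameters_pos:
  "gen_lam > 0" "gen_m > 0" "gen_r > 0" "gen_eta > 0" "gen_tau > 0"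
  using pos_poly_1
  by (simp_all add: gen_lam_def gen_m_def gen_r_def gen_eta_def gen_tau_def to_fract_pos_iff
      less_poly_def pos_poly_pCons)

lemma generic_somos4_nonzero:
  "\<exists>K. somos4 gen_lam gen_m gen_r gen_eta gen_tau K \<and> (\<forall>n\<ge>1. K n \<noteq> 0)"
proof -
  let ?K = "somos4_seq gen_lam gen_m gen_r gen_eta gen_tau"
  have "?K n \<noteq> 0" for n
    using somos4_seq_pos[OF generic_parameters_pos, of n] by simp
  then show ?thesis
    using somos4_somos4_seq[of gen_lam gen_m gen_r gen_eta gen_tau] by blast
qed

section \<open>Hankel determinants of the Somos fraction\<close>

theorem mainTheorem2:
  fixes lam m r eta tau :: "'a::field_char_0"
    and H :: "nat \<Rightarrow> 'a"
    and c :: "nat \<Rightarrow> 'a"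
    and G :: "'a fps"
  defines "c \<equiv> stieltjes_coeff lam m r eta tau"
    and "G \<equiv> stieltjes_fraction c"
  shows
    "(somos4 lam m r eta tau H \<and> (\<forall>n\<ge>1. H n \<noteq> 0) \<longrightarrow>
        \<comment> \<open>the recurrence determines the sequence\<close>
        (\<forall>H'. somos4 lam m r eta tau H' \<longrightarrow> H' = H) \<and>
        \<comment> \<open>no denominator in the definition of the coefficients vanishes\<close>
        lam \<noteq> 0 \<and> lam * r \<noteq> 0 \<and> m * r \<noteq> 0 \<and> m * eta \<noteq> 0 \<and> lam * eta \<noteq> 0 \<and>
        (\<forall>k\<ge>3. c (2 * k - 2) * c (2 * k - 1) \<noteq> 0 \<and> c (2 * k - 1) \<noteq> 0) \<and>
        (\<forall>j. c j \<noteq> 0) \<and>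
        (\<lambda>N. stieltjes_trunc N c) \<longlonglongrightarrow> G \<and>
        (\<forall>n\<ge>1. hankel_det (\<lambda>i. fps_nth G i) n = H n \<and>
                hankel_det (\<lambda>i. fps_nth G (i + 1)) n = H (n + 2)) \<and>
        (\<forall>n\<ge>2. c (2 * n - 1) = (H (n - 1) * H (n + 2)) / (H n * H (n + 1)) \<and>
                c (2 * n) = (H (n + 1))\<^sup>2 / (H n * H (n + 2))))
     \<and>
     \<comment> \<open>the generic case satisfies the hypotheses\<close>
     (\<exists>K. somos4 gen_lam gen_m gen_r gen_eta gen_tau K \<and> (\<forall>n\<ge>1. K n \<noteq> 0))"
proof (intro conjI impI generic_somos4_nonzero)
  assume *: "somos4 lam m r eta tau H \<and> (\<forall>n\<ge>1. H n \<noteq> 0)"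
  then have H: "somos4 lam m r eta tau H" and nz: "\<And>n. n \<ge> 1 \<Longrightarrow> H n \<noteq> 0"
    by simp_all
  note c_nz = somos4_stieltjes_coeff_nonzero[OF H nz, folded c_def]
  have init: "lam \<noteq> 0" "m \<noteq> 0" "r \<noteq> 0" "eta \<noteq> 0"
    using H nz[of 1] nz[of 2] nz[of 3] nz[of 4] by (auto simp: somos4_def)
  show "\<forall>H'. somos4 lam m r eta tau H' \<longrightarrow> H' = H"
    using somos4_unique[OF H nz] by blast
  show "lam \<noteq> 0" "lam * r \<noteq> 0" "m * r \<noteq> 0" "m * eta \<noteq> 0" "lam * eta \<noteq> 0"
    using init by simp_all
  show "\<forall>k\<ge>3. c (2 * k - 2) * c (2 * k - 1) \<noteq> 0 \<and> c (2 * k - 1) \<noteq> 0" "\<forall>j. c j \<noteq> 0"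
    using c_nz by simp_all
  show "(\<lambda>N. stieltjes_trunc N c) \<longlonglongrightarrow> G"
    unfolding G_def by (rule stieltjes_trunc_LIMSEQ)
  show "\<forall>n\<ge>1. hankel_det (\<lambda>i. fps_nth G i) n = H n \<and>
                hankel_det (\<lambda>i. fps_nth G (i + 1)) n = H (n + 2)"
    using hankel_det_somos4[OF H nz] shifted_hankel_det_somos4[OF H nz]
    by (auto simp: G_def c_def)
  show "\<forall>n\<ge>2. c (2 * n - 1) = (H (n - 1) * H (n + 2)) / (H n * H (n + 1)) \<and>
                c (2 * n) = (H (n + 1))\<^sup>2 / (H n * H (n + 2))"
    using somos4_stieltjes_coeff[OF H nz] by (auto simp: c_def)
qed

end
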